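(* Let $\Phi$ be a homogeneous Poisson point process on $\mathbb{R}^d$ with constant intensity $\rho>0$, let $\bm{x}\in\mathbb{R}^d$ be a fixed reference point, and for $l\ge1$ let $r_l$ be the Euclidean distance from $\bm{x}$ to its $l$-th nearest neighbor among the points of $\Phi$. Fix an integer $L\ge 2$ and define $\mu_{l}=r_{l}/r_{l-1}$ for $l=2,\dots,L$. Then $$\mu_l\sim\mathrm{Pareto}(1,(l-1)d),\qquad l=2,\dots,L,$$ and the random variables $\mu_2,\dots,\mu_L$ are jointly independent.
   Context: $\mathrm{Pareto}(1,\alpha)$ denotes the Pareto distribution with scale parameter $1$ and shape parameter $\alpha>0$, with density $\alpha t^{-\alpha-1}$ on $(1,\infty)$. *)

theory Defs
  imports "HOL-Probability.Probability"
begin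

definition pp_count :: "('w \<Rightarrow> 'a set) \<Rightarrow> 'a set \<Rightarrow> 'w \<Rightarrow> nat" where
  "pp_count \<Phi> B \<omega> = card (\<Phi> \<omega> \<inter> B)"

definition homogeneous_PPP ::
  "'w measure \<Rightarrow> ('w \<Rightarrow> 'a::euclidean_space set) \<Rightarrow> real \<Rightarrow> bool" where
  "homogeneous_PPP M \<Phi> \<rho> \<longleftrightarrow>
     prob_space M \<and>
     (\<forall>\<omega>\<in>space M. \<forall>B. bounded B \<longrightarrow> finite (\<Phi> \<omega> \<inter> B)) \<and>
     (\<forall>B. B \<in> sets lborel \<and> bounded B \<longrightarrow>
        pp_count \<Phi> B \<in> measurable M (count_space UNIV) \<and>
        (\<forall>k::nat. measure M {\<omega>\<in>space M. pp_count \<Phi> B \<omega> = k}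
            = (\<rho> * measure lborel B) ^ k / fact k * exp (- \<rho> * measure lborel B))) \<and>
     (\<forall>(I::nat set) (B::nat \<Rightarrow> 'a set).
        finite I \<and> (\<forall>i\<in>I. B i \<in> sets lborel \<and> bounded (B i)) \<and> disjoint_family_on B I \<longrightarrow>
        prob_space.indep_vars M (\<lambda>_. count_space UNIV) (\<lambda>i. pp_count \<Phi> (B i)) I)"

definition knn_dist :: "('w \<Rightarrow> 'a::euclidean_space set) \<Rightarrow> 'a \<Rightarrow> nat \<Rightarrow> 'w \<Rightarrow> real" where
  "knn_dist \<Phi> x l \<omega> = Inf {r::real. 0 \<le> r \<and> l \<le> card (\<Phi> \<omega> \<inter> cball x r)}"

definition pareto_density :: "real \<Rightarrow> real \<Rightarrow> real" where
  "pareto_density \<alpha> t = (if 1 < t then \<alpha> * t powr (- \<alpha> - 1) else 0)"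

end

theory Submission
  imports Defs
begin

text \<open>
  Fix \<open>s\<^sub>l > 1\<close>. Conditionally on there being exactly \<open>n\<close> points in a ball around \<open>x\<close>, the
  event that \<open>r\<^sub>l > s\<^sub>l r\<^sub>l\<^sub>-\<^sub>1\<close> for all \<open>l \<le> n\<close> has probability \<open>\<Prod>l. s\<^sub>l powr (- (l - 1) d)\<close>,
  whatever the radius of the ball and the configuration outside it. This goes by induction on
  \<open>n\<close>: locate the outermost point in a geometric grid of radii \<open>t q^i\<close> and replace
  \<open>r\<^sub>n > s r\<^sub>n\<^sub>-\<^sub>1\<close> by the statement that all \<open>n - 1\<close> inner points lie within \<open>1 / s\<close> times the
  inner (lower bound) or outer (upper bound) radius of the cell. Both bounds are geometric
  series, and they agree in the limit \<open>q \<rightarrow> 1\<close>. Letting \<open>s \<rightarrow> 1\<close> shows that conditions on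
  individual ratios may be dropped, so that the probability given any number \<open>n \<ge> L\<close> of points is
  the same; letting the ball grow then removes the conditioning.
\<close>

section \<open>Deterministic facts: attained distances, geometric grids and series, the Pareto
  integral\<close>

text \<open>The number of points in \<open>cball x r\<close> changes only when \<open>r\<close>
  passes the distance of some point from \<open>x\<close>. Any radius in the set can therefore be
  lowered to one of finitely many candidates, and the infimum is a minimum.\<close>

lemma knn_dist_attained:
  assumes fin: "\<And>r. finite (\<Phi> \<omega> \<inter> cball x r)"
    and r: "0 \<le> r" "l \<le> card (\<Phi> \<omega> \<inter> cball x r)"
  shows "0 \<le> knn_dist \<Phi> x l \<omega>" "knn_dist \<Phi> x l \<omega> \<le> r"
    "l \<le> card (\<Phi> \<omega> \<inter> cball x (knn_dist \<Phi> x l \<omega>))"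
proof -
  define S where "S = {r::real. 0 \<le> r \<and> l \<le> card (\<Phi> \<omega> \<inter> cball x r)}"
  \<comment> \<open>The value 0 serves the case where the ball contains no point at all, which can
    occur for \<open>l = 0\<close>.\<close>
  define D where "D = insert 0 (dist x ` (\<Phi> \<omega> \<inter> cball x r))"
  have finD: "finite D"
    using fin by (simp add: D_def)
  have *: "\<exists>r'\<in>S \<inter> D. r' \<le> u" if u: "u \<in> S" "u \<le> r" for u
  proof -
    define r' where "r' = Max {d\<in>D. d \<le> u}"
    have ne: "{d\<in>D. d \<le> u} \<noteq> {}"
      using u by (auto simp: D_def S_def)
    have r': "r' \<in> {d\<in>D. d \<le> u}"
      unfolding r'_def using ne finD by (intro Max_in) auto
    have "dist x p \<le> r'" if "p \<in> \<Phi> \<omega>" "dist x p \<le> u" for p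
      unfolding r'_def using that finD u by (intro Max_ge) (auto simp: D_def)
    then have "\<Phi> \<omega> \<inter> cball x r' = \<Phi> \<omega> \<inter> cball x u"
      using r' by auto
    moreover have "0 \<le> r'"
      using r' by (auto simp: D_def)
    ultimately show ?thesis
      using r' u by (auto simp: S_def)
  qed
  define m where "m = Min (S \<inter> D)"
  have "r \<in> S"
    using r by (simp add: S_def)
  then have "S \<inter> D \<noteq> {}"
    using * by blast
  then have m: "m \<in> S \<inter> D"
    unfolding m_def using finD by (intro Min_in) auto
  have le: "m \<le> u" if "u \<in> S" for u
  proof -
    have le': "m \<le> u'" if "u' \<in> S" "u' \<le> r" for u'
      using *[OF that] finD unfolding m_def by (meson Min_le finite_Int order_trans)
    show ?thesis
      using le'[OF that] le'[OF \<open>r \<in> S\<close>] by linarith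
  qed
  have "knn_dist \<Phi> x l \<omega> = m"
    unfolding knn_dist_def S_def[symmetric] using m le by (intro cInf_eq_minimum) auto
  then show "0 \<le> knn_dist \<Phi> x l \<omega>" "knn_dist \<Phi> x l \<omega> \<le> r"
    "l \<le> card (\<Phi> \<omega> \<inter> cball x (knn_dist \<Phi> x l \<omega>))"
    using m le[OF \<open>r \<in> S\<close>] by (auto simp: S_def)
qed

definition poisson_mass :: "real \<Rightarrow> nat \<Rightarrow> real" where
  "poisson_mass v k = v ^ k / fact k * exp (- v)"

lemma poisson_mass_nonneg: "0 \<le> v \<Longrightarrow> 0 \<le> poisson_mass v k"
  by (simp add: poisson_mass_def)

text \<open>The bracketed factor is the reciprocal of the average of 1, Q, ..., Q^j, and that
  average lies between Q^j and 1. It is the factor that remains after summing the series over the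
  cells of the grid.\<close>

lemma geometric_ratio_bounds:
  fixes Q :: real
  assumes "0 < Q" "Q < 1"
  shows "Q ^ j \<le> Q ^ j * (real (Suc j) * (1 - Q) / (1 - Q ^ Suc j))"
    and "Q ^ j * (real (Suc j) * (1 - Q) / (1 - Q ^ Suc j)) \<le> 1"
proof -
  have S: "1 - Q ^ Suc j = (1 - Q) * (\<Sum>i<Suc j. Q ^ i)"
    using one_diff_power_eq by blast
  have "(\<Sum>i<Suc j. Q ^ i) \<le> (\<Sum>i<Suc j. 1)"
    using assms by (intro sum_mono power_le_one) auto
  then have 1: "(\<Sum>i<Suc j. Q ^ i) \<le> real (Suc j)"
    by simp
  have "(\<Sum>i<Suc j. Q ^ j) \<le> (\<Sum>i<Suc j. Q ^ i)"
    using assms by (intro sum_mono power_decreasing) auto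
  then have 2: "real (Suc j) * Q ^ j \<le> (\<Sum>i<Suc j. Q ^ i)"
    by simp
  have pos: "0 < (\<Sum>i<Suc j. Q ^ i)"
    using assms by (intro sum_pos) auto
  have eq: "real (Suc j) * (1 - Q) / (1 - Q ^ Suc j) = real (Suc j) / (\<Sum>i<Suc j. Q ^ i)"
    unfolding S using assms by (simp del: sum.lessThan_Suc)
  have "1 \<le> real (Suc j) / (\<Sum>i<Suc j. Q ^ i)"
    using 1 pos by (simp del: sum.lessThan_Suc)
  then show "Q ^ j \<le> Q ^ j * (real (Suc j) * (1 - Q) / (1 - Q ^ Suc j))"
    unfolding eq using assms by (intro mult_le_cancel_left1[THEN iffD2]) auto
  show "Q ^ j * (real (Suc j) * (1 - Q) / (1 - Q ^ Suc j)) \<le> 1"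
    unfolding eq using 2 pos by (simp add: divide_le_eq mult.commute del: sum.lessThan_Suc)
qed

lemma geometric_cell:
  fixes q r t :: real
  assumes "0 < q" "q < 1" "0 < r" "r \<le> t"
  shows "\<exists>i. t * q ^ Suc i < r \<and> r \<le> t * q ^ i"
proof -
  have t: "0 < t" using assms by simp
  obtain n where n: "q ^ n < r / t"
    using real_arch_pow_inv[of "r / t" q] assms t by auto
  \<comment> \<open>The least exponent whose power drops below \<open>r / t\<close> is positive
    because \<open>r \<le> t\<close>; its predecessor indexes the cell.\<close>
  define k where "k = (LEAST n. q ^ n < r / t)"
  have k: "q ^ k < r / t"
    unfolding k_def using n by (rule LeastI)
  have "k \<noteq> 0"
    using k assms t by (intro notI) simp
  then obtain i where i: "k = Suc i"
    using not0_implies_Suc by blast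
  then have "\<not> q ^ i < r / t"
    using not_less_Least[of i "\<lambda>n. q ^ n < r / t"] unfolding k_def by simp
  then show ?thesis
    using k i t by (intro exI[of _ i]) (simp add: field_simps not_less)
qed

lemma nn_integral_pareto_density_atMost:
  assumes "0 < \<alpha>"
  shows "(\<integral>\<^sup>+t. ennreal (pareto_density \<alpha> t * indicator {..a} t) \<partial>lborel) =
    ennreal (1 - max 1 a powr (- \<alpha>))"
proof (cases "1 \<le> a")
  case False
  then have "(\<integral>\<^sup>+t. ennreal (pareto_density \<alpha> t * indicator {..a} t) \<partial>lborel) = (\<integral>\<^sup>+(t::real). 0 \<partial>lborel)"
    by (intro nn_integral_cong) (auto simp: pareto_density_def indicator_def)
  then show ?thesis
    using False by (simp add: max_def)
next
  case True
  \<comment> \<open>At 1 the density is 0 but the power formula is not. The fundamental theorem of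
    calculus is applied on the closed interval, so this null point is set aside.\<close>
  have "AE t in lborel. t \<noteq> (1::real)"
    by (rule AE_lborel_singleton)
  then have "(\<integral>\<^sup>+t. ennreal (pareto_density \<alpha> t * indicator {..a} t) \<partial>lborel) =
      (\<integral>\<^sup>+t. ennreal (\<alpha> * t powr (- \<alpha> - 1)) * indicator {1..a} t \<partial>lborel)"
    by (intro nn_integral_cong_AE, eventually_elim) (auto simp: pareto_density_def indicator_def)
  also have "\<dots> = ennreal (- (a powr (- \<alpha>)) - (- (1 powr (- \<alpha>))))"
  proof (rule nn_integral_FTC_Icc)
    fix t :: real assume t: "t \<in> {1..a}"
    show "((\<lambda>t. - (t powr (- \<alpha>))) has_real_derivative \<alpha> * t powr (- \<alpha> - 1)) (at t)"
      using DERIV_minus[OF has_real_derivative_powr[of t "- \<alpha>"]] t by simp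
    show "0 \<le> \<alpha> * t powr (- \<alpha> - 1)"
      using assms by simp
  qed (use True in auto)
  finally show ?thesis
    using True by (simp add: max_def)
qed

section \<open>Counts in balls around the reference point\<close>

locale homogeneous_poisson = prob_space M for M :: "'w measure" +
  fixes \<Phi> :: "'w \<Rightarrow> 'a::euclidean_space set" and \<rho> :: real and x :: 'a
  assumes ppp: "homogeneous_PPP M \<Phi> \<rho>" and rho_pos: "0 < \<rho>"
begin

abbreviation N :: "real \<Rightarrow> 'w \<Rightarrow> nat" where
  "N r \<equiv> pp_count \<Phi> (cball x r)"

abbreviation R :: "nat \<Rightarrow> 'w \<Rightarrow> real" where
  "R l \<equiv> knn_dist \<Phi> x l"

text \<open>The Poisson parameter of the count \<open>N r\<close>.\<close>

definition V :: "real \<Rightarrow> real" where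
  "V r = \<rho> * measure lborel (cball x r)"

definition \<kappa> :: real where
  "\<kappa> = \<rho> * unit_ball_vol (real DIM('a))"

lemma V_eq: "0 \<le> r \<Longrightarrow> V r = \<kappa> * r ^ DIM('a)"
  by (simp add: V_def \<kappa>_def content_cball)

lemma kappa_pos: "0 < \<kappa>"
  using rho_pos by (simp add: \<kappa>_def)

lemma V_nonneg: "0 \<le> V r"
  using rho_pos by (simp add: V_def)

lemma finite_points: "\<omega> \<in> space M \<Longrightarrow> bounded B \<Longrightarrow> finite (\<Phi> \<omega> \<inter> B)"
  using ppp by (simp add: homogeneous_PPP_def)

lemma measurable_count:
  "B \<in> sets lborel \<Longrightarrow> bounded B \<Longrightarrow> pp_count \<Phi> B \<in> measurable M (count_space UNIV)"
  using ppp by (simp add: homogeneous_PPP_def)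

lemma measurable_N [measurable]: "N r \<in> measurable M (count_space UNIV)"
  by (rule measurable_count) auto

lemma prob_count:
  "B \<in> sets lborel \<Longrightarrow> bounded B \<Longrightarrow>
    prob {\<omega>\<in>space M. pp_count \<Phi> B \<omega> = k} = poisson_mass (\<rho> * measure lborel B) k"
  using ppp by (simp add: homogeneous_PPP_def poisson_mass_def)

lemma prob_N: "prob {\<omega>\<in>space M. N r \<omega> = k} = poisson_mass (V r) k"
  by (simp add: prob_count V_def)

lemma N_mono: "\<omega> \<in> space M \<Longrightarrow> r \<le> s \<Longrightarrow> N r \<omega> \<le> N s \<omega>"
  unfolding pp_count_def by (intro card_mono finite_points) auto

lemma R_le:
  assumes "\<omega> \<in> space M" "0 \<le> r" "l \<le> N r \<omega>"
  shows "0 \<le> R l \<omega>" "R l \<omega> \<le> r"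
  using assms knn_dist_attained[of \<Phi> \<omega> x r l] finite_points[of \<omega> "cball x _"]
  by (auto simp: pp_count_def)

text \<open>Translates between distances and counts; all later probabilities of distance events are
  computed through it. The radius \<open>t\<close> only certifies that \<open>l\<close> points
  exist, so that the infimum defining \<open>R l\<close> is over a nonempty set.\<close>

lemma R_le_iff:
  assumes "\<omega> \<in> space M" "0 \<le> t" "l \<le> N t \<omega>" "0 \<le> r"
  shows "R l \<omega> \<le> r \<longleftrightarrow> l \<le> N r \<omega>"
proof
  assume "R l \<omega> \<le> r"
  moreover have "l \<le> N (R l \<omega>) \<omega>"
    using assms knn_dist_attained(3)[of \<Phi> \<omega> x t l] finite_points[of \<omega> "cball x _"]
    by (auto simp: pp_count_def)
  ultimately show "l \<le> N r \<omega>"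
    using N_mono[OF assms(1)] order_trans by blast
qed (use R_le assms in auto)

text \<open>On the event that there are fewer than \<open>l\<close> points altogether, \<open>R l\<close> is the
  junk value \<open>Inf {}\<close>, so this event has to be split off.\<close>

lemma measurable_R [measurable]: "R l \<in> borel_measurable M"
proof (rule borel_measurableI_le)
  fix a :: real
  define F where "F = (\<Union>m::nat. {\<omega>\<in>space M. l \<le> N (real m) \<omega>})"
  have F: "F \<in> events"
    unfolding F_def by measurable
  have FI: "\<omega> \<in> F" if "\<omega> \<in> space M" "l \<le> N r \<omega>" for \<omega> r
  proof -
    obtain m :: nat where "r \<le> real m"
      using real_arch_simple by blast
    then show ?thesis
      using N_mono[OF that(1)] that unfolding F_def by (auto intro: order_trans)
  qed
  have FD: "\<exists>t\<ge>0. l \<le> N t \<omega>" if "\<omega> \<in> F" for \<omega>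
    using that of_nat_0_le_iff unfolding F_def by blast
  have "{\<omega>\<in>space M. R l \<omega> \<le> a} =
      {\<omega>\<in>space M. \<omega> \<in> F \<and> 0 \<le> a \<and> l \<le> N a \<omega>} \<union> {\<omega>\<in>space M. \<omega> \<notin> F \<and> Inf ({}::real set) \<le> a}"
  proof (intro set_eqI)
    fix \<omega>
    show "\<omega> \<in> {\<omega>\<in>space M. R l \<omega> \<le> a} \<longleftrightarrow>
      \<omega> \<in> {\<omega>\<in>space M. \<omega> \<in> F \<and> 0 \<le> a \<and> l \<le> N a \<omega>} \<union> {\<omega>\<in>space M. \<omega> \<notin> F \<and> Inf ({}::real set) \<le> a}"
    proof (cases "\<omega> \<in> space M")
      case sp: True
      show ?thesis
      proof (cases "\<omega> \<in> F")
        case True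
        then obtain t where t: "t \<ge> 0" "l \<le> N t \<omega>"
          using FD by blast
        have "0 \<le> R l \<omega>"
          by (rule R_le[OF sp t])
        then show ?thesis
          using sp True R_le_iff[OF sp t, of a] by auto
      next
        case False
        then have "{r::real. 0 \<le> r \<and> l \<le> card (\<Phi> \<omega> \<inter> cball x r)} = {}"
          using FI[OF sp] by (auto simp: pp_count_def)
        then have "R l \<omega> = Inf {}"
          by (simp only: knn_dist_def)
        then show ?thesis
          using sp False by simp
      qed
    qed simp
  qed
  also have "\<dots> \<in> events"
    using F by measurable
  finally show "{\<omega>\<in>space M. R l \<omega> \<le> a} \<in> events" .
qed

section \<open>Joint counts in disjoint sets outside a ball\<close>

text \<open>Such a family, with prescribed counts, describes the configuration outside the ball of
  radius \<open>t\<close>.\<close>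

definition admissible :: "real \<Rightarrow> nat \<Rightarrow> (nat \<Rightarrow> 'a set) \<Rightarrow> bool" where
  "admissible t n B \<longleftrightarrow>
    (\<forall>i<n. B i \<in> sets lborel \<and> bounded (B i) \<and> B i \<inter> cball x t = {}) \<and> disjoint_family_on B {..<n}"

definition counts :: "nat \<Rightarrow> (nat \<Rightarrow> 'a set) \<Rightarrow> (nat \<Rightarrow> nat) \<Rightarrow> 'w set" where
  "counts n B m = {\<omega>\<in>space M. \<forall>i<n. pp_count \<Phi> (B i) \<omega> = m i}"

lemma indep_counts:
  fixes B :: "nat \<Rightarrow> 'a set"
  assumes "\<And>i. i < n \<Longrightarrow> B i \<in> sets lborel \<and> bounded (B i)" "disjoint_family_on B {..<n}"
  shows "indep_vars (\<lambda>_. count_space UNIV) (\<lambda>i. pp_count \<Phi> (B i)) {..<n}"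
proof -
  have "\<forall>I B. finite I \<and> (\<forall>i\<in>I. B i \<in> sets lborel \<and> bounded (B i)) \<and> disjoint_family_on B I \<longrightarrow>
      indep_vars (\<lambda>_. count_space UNIV) (\<lambda>i. pp_count \<Phi> (B i :: 'a set)) (I :: nat set)"
    using ppp unfolding homogeneous_PPP_def by (elim conjE)
  from this[rule_format, of "{..<n}" B] show ?thesis
    using assms by simp
qed

text \<open>Shrinking the ball from \<open>t\<close> to \<open>s\<close> frees the region between,
  and a set \<open>b\<close> inside that region can join the family in front. A negative
  \<open>s\<close> is allowed: the smaller ball is then empty.\<close>

lemma admissible_Suc:
  assumes "admissible t n B" "b \<in> sets lborel" "bounded b" "b \<subseteq> cball x t" "b \<inter> cball x s = {}" "s \<le> t"
  shows "admissible s (Suc n) (case_nat b B)"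
proof -
  have "cball x s \<subseteq> cball x t"
    using assms by auto
  then have "\<forall>i<Suc n. case_nat b B i \<in> sets lborel \<and> bounded (case_nat b B i) \<and>
      case_nat b B i \<inter> cball x s = {}"
    using assms(1-5) unfolding admissible_def All_less_Suc2 by (simp del: mem_cball) blast
  moreover have "disjoint_family_on (case_nat b B) {..<Suc n}"
    unfolding disjoint_family_on_def
  proof (intro ballI impI)
    fix i j assume ij: "i \<in> {..<Suc n}" "j \<in> {..<Suc n}" "i \<noteq> j"
    have *: "b \<inter> B k = {}" if "k < n" for k
      using assms(1,4) that unfolding admissible_def by blast
    show "case_nat b B i \<inter> case_nat b B j = {}"
      using ij * assms(1) disjoint_family_onD[of B "{..<n}" "i - 1" "j - 1"]
      by (cases i; cases j) (auto simp: admissible_def Int_commute simp del: mem_cball)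
  qed
  ultimately show ?thesis
    by (simp add: admissible_def)
qed

lemma counts_Suc: "counts (Suc n) (case_nat b B) (case_nat k m) =
    {\<omega>\<in>space M. pp_count \<Phi> b \<omega> = k} \<inter> counts n B m"
  by (auto simp: counts_def All_less_Suc2)

lemma counts_events:
  assumes "admissible t n B"
  shows "counts n B m \<in> events"
proof -
  have "{\<omega>\<in>space M. pp_count \<Phi> (B i) \<omega> = m i} \<in> events" if "i < n" for i
    using measurable_count[of "B i"] assms that by (auto simp: admissible_def)
  then have "{\<omega>\<in>space M. \<forall>i\<in>{..<n}. pp_count \<Phi> (B i) \<omega> = m i} \<in> events"
    by (intro sets.sets_Collect_finite_All) auto
  then show ?thesis
    unfolding counts_def by (simp only: Ball_def lessThan_iff)
qed

lemma prob_counts: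
  assumes "\<And>i. i < n \<Longrightarrow> B i \<in> sets lborel \<and> bounded (B i)" "disjoint_family_on B {..<n}"
  shows "prob (counts n B m) = (\<Prod>i<n. poisson_mass (\<rho> * measure lborel (B i)) (m i))"
\<comment> \<open>Over an empty index set the intersection below would be \<open>UNIV\<close>
  instead of \<open>space M\<close>.\<close>
proof (cases "n = 0")
  case True
  then show ?thesis by (simp add: counts_def prob_space)
next
  case False
  have "indep_vars (\<lambda>_. count_space UNIV) (\<lambda>i. pp_count \<Phi> (B i)) {..<n}"
    by (rule indep_counts[OF assms])
  from indep_varsD_finite[OF this, of "\<lambda>i. {m i}"] False
  have "prob (\<Inter>i\<in>{..<n}. pp_count \<Phi> (B i) -` {m i} \<inter> space M) =
      (\<Prod>i<n. prob (pp_count \<Phi> (B i) -` {m i} \<inter> space M))"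
    by auto
  also have "(\<Inter>i\<in>{..<n}. pp_count \<Phi> (B i) -` {m i} \<inter> space M) = counts n B m"
    using False by (auto simp: counts_def)
  also have "(\<Prod>i<n. prob (pp_count \<Phi> (B i) -` {m i} \<inter> space M)) =
      (\<Prod>i<n. poisson_mass (\<rho> * measure lborel (B i)) (m i))"
  proof (rule prod.cong)
    fix i assume "i \<in> {..<n}"
    moreover have "pp_count \<Phi> (B i) -` {m i} \<inter> space M = {\<omega>\<in>space M. pp_count \<Phi> (B i) \<omega> = m i}"
      by auto
    ultimately show "prob (pp_count \<Phi> (B i) -` {m i} \<inter> space M) =
        poisson_mass (\<rho> * measure lborel (B i)) (m i)"
      using assms(1) prob_count by simp
  qed simp
  finally show ?thesis .
qed

lemma prob_counts_Suc:
  assumes "admissible s (Suc n) (case_nat b B)"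
  shows "prob (counts (Suc n) (case_nat b B) (case_nat k m)) =
    poisson_mass (\<rho> * measure lborel b) k * prob (counts n B m)"
proof -
  have 1: "prob (counts (Suc n) (case_nat b B) (case_nat k m)) =
    (\<Prod>i<Suc n. poisson_mass (\<rho> * measure lborel (case_nat b B i)) (case_nat k m i))"
    using assms by (intro prob_counts) (auto simp: admissible_def)
  have "disjoint_family_on B {..<n}"
    unfolding disjoint_family_on_def
  proof (intro ballI impI)
    fix i j assume "i \<in> {..<n}" "j \<in> {..<n}" "i \<noteq> j"
    then show "B i \<inter> B j = {}"
      using assms disjoint_family_onD[of "case_nat b B" "{..<Suc n}" "Suc i" "Suc j"]
      by (simp add: admissible_def)
  qed
  then have 2: "prob (counts n B m) = (\<Prod>i<n. poisson_mass (\<rho> * measure lborel (B i)) (m i))"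
    using assms by (intro prob_counts) (auto simp: admissible_def All_less_Suc2)
  show ?thesis
    unfolding 1 2 by (subst prod.lessThan_Suc_shift) simp
qed

text \<open>Factoring out an arbitrary event outside the ball is all of the strong Markov property
  that the induction over the points needs.\<close>

definition count_indep :: "'w set \<Rightarrow> nat \<Rightarrow> real \<Rightarrow> bool" where
  "count_indep A j c \<longleftrightarrow> A \<in> events \<and> 0 \<le> c \<and> (\<forall>t>0. \<forall>n B m. admissible t n B \<longrightarrow>
    prob (A \<inter> {\<omega>\<in>space M. N t \<omega> = j} \<inter> counts n B m) =
      c * poisson_mass (V t) j * prob (counts n B m))"

lemma count_indepD:
  "count_indep A j c \<Longrightarrow> 0 < t \<Longrightarrow> admissible t n B \<Longrightarrow>
    prob (A \<inter> {\<omega>\<in>space M. N t \<omega> = j} \<inter> counts n B m) =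
      c * poisson_mass (V t) j * prob (counts n B m)"
  by (simp add: count_indep_def)

lemma count_indep_space: "count_indep (space M) j 1"
  unfolding count_indep_def
proof (intro conjI allI impI)
  fix t n B m assume t: "0 < t" and adm: "admissible t n B"
  \<comment> \<open>The ball of radius -1 is empty, so the whole of \<open>cball x t\<close> may be
    prepended to the family.\<close>
  have "admissible (-1) (Suc n) (case_nat (cball x t) B)"
    using t by (intro admissible_Suc[OF adm]) auto
  from prob_counts_Suc[OF this, of j m]
  show "prob (space M \<inter> {\<omega>\<in>space M. N t \<omega> = j} \<inter> counts n B m) =
      1 * poisson_mass (V t) j * prob (counts n B m)"
    unfolding counts_Suc by (simp add: V_def Int_assoc[symmetric] Int_absorb1 subset_eq)
qed simp_all

section \<open>Annuli and the law of one further ratio\<close>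

text \<open>The outer sphere is included and the inner one is not, which matches conditions of the
  form \<open>a < R l \<omega> \<and> R l \<omega> \<le> b\<close>.\<close>

definition annulus :: "real \<Rightarrow> real \<Rightarrow> 'a set" where
  "annulus a b = cball x b - cball x a"

lemma annulus_simps [simp]: "annulus a b \<in> sets borel" "bounded (annulus a b)"
  "annulus a b \<inter> cball x a = {}"
  by (auto simp: annulus_def intro: bounded_subset)

lemma annulus_subset: "b \<le> t \<Longrightarrow> annulus a b \<subseteq> cball x t"
  by (auto simp: annulus_def)

lemma measure_annulus:
  assumes "a \<le> b"
  shows "\<rho> * measure lborel (annulus a b) = V b - V a"
proof -
  have "measure lborel (annulus a b) = measure lborel (cball x b) - measure lborel (cball x a)"
    unfolding annulus_def using assms emeasure_lborel_cball_finite[of x b]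
    by (intro measure_Diff) auto
  then show ?thesis
    by (simp add: V_def right_diff_distrib)
qed

lemma N_annulus:
  assumes "\<omega> \<in> space M" "a \<le> b"
  shows "N b \<omega> = N a \<omega> + pp_count \<Phi> (annulus a b) \<omega>"
proof -
  have "\<Phi> \<omega> \<inter> cball x b = (\<Phi> \<omega> \<inter> cball x a) \<union> (\<Phi> \<omega> \<inter> annulus a b)"
    using assms by (auto simp: annulus_def)
  moreover have "(\<Phi> \<omega> \<inter> cball x a) \<inter> (\<Phi> \<omega> \<inter> annulus a b) = {}"
    by (auto simp: annulus_def)
  ultimately show ?thesis
    unfolding pp_count_def using assms by (simp only:) (intro card_Un_disjoint finite_points, auto)
qed

text \<open>The event puts \<open>j\<close> points within \<open>u\<close>, none between
  \<open>u\<close> and \<open>a\<close>, one between \<open>a\<close> and \<open>b\<close>, and none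
  between \<open>b\<close> and \<open>t\<close>. The three annuli are prepended to the outer family,
  from the outermost inwards, and the independence of \<open>A\<close> is used at radius
  \<open>u\<close>. The exponentials then telescope to \<open>exp (- V t)\<close>.\<close>

lemma prob_cell:
  assumes A: "count_indep A j c" and u: "0 < u" "u \<le> a" "a \<le> b" "b \<le> t"
    and adm: "admissible t n B"
  shows "prob (A \<inter> {\<omega>\<in>space M. N u \<omega> = j \<and> N a \<omega> = j \<and> N b \<omega> = Suc j \<and> N t \<omega> = Suc j} \<inter> counts n B m)
    = c * (V u ^ j / fact j * (V b - V a) * exp (- V t)) * prob (counts n B m)"
proof -
  note a3 = admissible_Suc[OF adm _ _ annulus_subset[of t t b], of b]
  have adm3: "admissible b (Suc n) (case_nat (annulus b t) B)"
    using u a3 by simp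
  note a2 = admissible_Suc[OF adm3 _ _ annulus_subset[of b b a], of a]
  have adm2: "admissible a (Suc (Suc n)) (case_nat (annulus a b) (case_nat (annulus b t) B))"
    using u a2 by simp
  note a1 = admissible_Suc[OF adm2 _ _ annulus_subset[of a a u], of u]
  have adm1: "admissible u (Suc (Suc (Suc n)))
      (case_nat (annulus u a) (case_nat (annulus a b) (case_nat (annulus b t) B)))"
    using u a1 by simp
  define C where "C = counts (Suc (Suc (Suc n)))
      (case_nat (annulus u a) (case_nat (annulus a b) (case_nat (annulus b t) B)))
      (case_nat 0 (case_nat 1 (case_nat 0 m)))"
  have "A \<inter> {\<omega>\<in>space M. N u \<omega> = j \<and> N a \<omega> = j \<and> N b \<omega> = Suc j \<and> N t \<omega> = Suc j} \<inter> counts n B m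
      = A \<inter> {\<omega>\<in>space M. N u \<omega> = j} \<inter> C"
    unfolding C_def counts_Suc using N_annulus u by auto
  moreover have "prob (A \<inter> {\<omega>\<in>space M. N u \<omega> = j} \<inter> C) = c * poisson_mass (V u) j * prob C"
    unfolding C_def using count_indepD[OF A u(1) adm1] by simp
  moreover have "prob C = poisson_mass (V a - V u) 0 * (poisson_mass (V b - V a) 1 *
      (poisson_mass (V t - V b) 0 * prob (counts n B m)))"
    unfolding C_def prob_counts_Suc[OF adm1] prob_counts_Suc[OF adm2] prob_counts_Suc[OF adm3]
    using u by (simp add: measure_annulus)
  ultimately have "prob (A \<inter> {\<omega>\<in>space M. N u \<omega> = j \<and> N a \<omega> = j \<and> N b \<omega> = Suc j \<and> N t \<omega> = Suc j} \<inter> counts n B m)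
    = c * (V u ^ j / fact j * exp (- V u)) * (exp (- (V a - V u)) * ((V b - V a) * exp (- (V b - V a)) *
      (exp (- (V t - V b)) * prob (counts n B m))))"
    by (simp only: poisson_mass_def power_0 power_one_right fact_0 fact_1 div_by_1 mult_1)
  also have "\<dots> = c * (V u ^ j / fact j * (V b - V a) *
      (exp (- V u) * (exp (- (V a - V u)) * (exp (- (V b - V a)) * exp (- (V t - V b)))))) * prob (counts n B m)"
    by (simp only: mult_ac)
  also have "\<dots> = c * (V u ^ j / fact j * (V b - V a) * exp (- V t)) * prob (counts n B m)"
    by (simp add: mult_exp_exp)
  finally show ?thesis .
qed

lemma AE_N_0: "AE \<omega> in M. N 0 \<omega> = 0"
proof -
  have "prob {\<omega>\<in>space M. N 0 \<omega> = 0} = 1"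
    unfolding prob_N by (simp add: poisson_mass_def V_def)
  moreover have "{\<omega>\<in>space M. N 0 \<omega> = 0} \<in> events"
    by measurable
  ultimately show ?thesis
    using prob_Collect_eq_1[of "\<lambda>\<omega>. N 0 \<omega> = 0"] by blast
qed

text \<open>\<open>G\<close> is the probability sought and \<open>W\<close> its claimed value. The
  event is split by the shell of the grid \<open>t * q ^ i\<close> that contains the outermost
  point. Replacing the exact position of that point by the inner or outer radius of its shell gives
  two series of ratio Q^(j+1) with Q = q^d, whose terms differ by the factor Q^j. Each sum differs
  from \<open>W\<close> by a factor that \<open>geometric_ratio_bounds\<close> controls.\<close>

lemma count_indep_ratio_bounds:
  fixes m :: "nat \<Rightarrow> nat"
  assumes A: "count_indep A j c" and s: "1 < s" and t: "0 < t" and adm: "admissible t n B"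
    and q: "1 / s \<le> q" "q < 1"
  defines "G \<equiv> prob (A \<inter> {\<omega>\<in>space M. s * R j \<omega> < R (Suc j) \<omega>} \<inter> {\<omega>\<in>space M. N t \<omega> = Suc j} \<inter> counts n B m)"
    and "W \<equiv> c * (1 / s) ^ (j * DIM('a)) * poisson_mass (V t) (Suc j) * prob (counts n B m)"
  shows "W * q ^ (j * DIM('a)) \<le> G" "G * q ^ (j * DIM('a)) \<le> W"
proof -
  define d where "d = DIM('a)"
  define H where "H = counts n B m"
  have [measurable]: "A \<in> events" "H \<in> events"
    using A counts_events[OF adm] by (auto simp: count_indep_def H_def)
  have c: "0 \<le> c"
    using A by (simp add: count_indep_def)
  have q0: "0 < q"
    using q s by (meson divide_pos_pos less_le_trans less_trans zero_less_one)
  define b where "b i = t * q ^ i" for i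
  define F where "F = A \<inter> {\<omega>\<in>space M. s * R j \<omega> < R (Suc j) \<omega>} \<inter> {\<omega>\<in>space M. N t \<omega> = Suc j} \<inter> H"
  define cell where "cell i = F \<inter> {\<omega>\<in>space M. b (Suc i) < R (Suc j) \<omega> \<and> R (Suc j) \<omega> \<le> b i}" for i
  have F [measurable]: "F \<in> events"
    unfolding F_def by measurable
  have cell [measurable]: "cell i \<in> events" for i
    unfolding cell_def by measurable
  have b: "0 < b i" "b (Suc i) \<le> b i" "b i \<le> t" for i
    using t q0 q by (auto simp: b_def mult_le_cancel_left1 power_le_one mult_left_le_one_le)
  have b_anti: "b k \<le> b i" if "i \<le> k" for i k
    using t q0 q that by (auto simp: b_def power_decreasing)
  have "disjoint_family cell"
  proof -
    have "cell i \<inter> cell k = {}" if "i < k" for i k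
      using b_anti[of "Suc i" k] that by (auto simp: cell_def)
    then show ?thesis
      unfolding disjoint_family_on_def by (metis Int_commute linorder_neqE_nat)
  qed
  then have sums_cell: "(\<lambda>i. prob (cell i)) sums prob (\<Union>i. cell i)"
    by (intro finite_measure_UNION) auto
  \<comment> \<open>The cells cover positive radii only. The remaining case
    \<open>R (Suc j) \<omega> = 0\<close> would put a point of the process at \<open>x\<close>,
    which has probability 0.\<close>
  have "prob F = prob (\<Union>i. cell i)"
  proof (rule finite_measure_eq_AE)
    show "AE \<omega> in M. \<omega> \<in> F \<longleftrightarrow> \<omega> \<in> (\<Union>i. cell i)"
      using AE_N_0
    proof eventually_elim
      case (elim \<omega>)
      show ?case
      proof
        assume "\<omega> \<in> F"
        then have w: "\<omega> \<in> space M" "N t \<omega> = Suc j"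
          by (auto simp: F_def)
        have "R (Suc j) \<omega> \<le> t" "\<not> R (Suc j) \<omega> \<le> 0"
          using R_le[of \<omega> t "Suc j"] R_le_iff[of \<omega> t "Suc j" 0] w t elim by auto
        then obtain i where "t * q ^ Suc i < R (Suc j) \<omega> \<and> R (Suc j) \<omega> \<le> t * q ^ i"
          using geometric_cell[of q "R (Suc j) \<omega>" t] q0 q by auto
        then show "\<omega> \<in> (\<Union>i. cell i)"
          using \<open>\<omega> \<in> F\<close> w by (auto simp: cell_def b_def)
      qed (auto simp: cell_def)
    qed
  qed auto
  then have G: "(\<lambda>i. prob (cell i)) sums G"
    using sums_cell by (simp add: G_def F_def H_def)
  define Q where "Q = q ^ d"
  have d: "d \<noteq> 0"
    by (simp add: d_def)
  have Q: "0 < Q" "Q < 1"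
    using q0 q d by (auto simp: Q_def power_less_one_iff)
  define T where "T u i = c * (V u ^ j / fact j * (V (b i) - V (b (Suc i))) * exp (- V t)) * prob H" for u i
  \<comment> \<open>A sufficient condition for the cell: if the \<open>j\<close> inner points lie
    within \<open>b (Suc i) / s\<close> and the next one lies beyond \<open>b (Suc i)\<close>, the
    ratio exceeds \<open>s\<close>.\<close>
  have lower: "T (b (Suc i) / s) i \<le> prob (cell i)" for i
  proof -
    have u: "0 < b (Suc i) / s" "b (Suc i) / s \<le> b (Suc i)"
      using b[of "Suc i"] s by (auto simp: field_simps)
    have "T (b (Suc i) / s) i = prob (A \<inter> {\<omega>\<in>space M. N (b (Suc i) / s) \<omega> = j \<and> N (b (Suc i)) \<omega> = j \<and>
        N (b i) \<omega> = Suc j \<and> N t \<omega> = Suc j} \<inter> H)"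
      unfolding T_def H_def by (rule prob_cell[OF A u b(2) b(3) adm, symmetric])
    also have "\<dots> \<le> prob (cell i)"
    proof (rule finite_measure_mono)
      show "A \<inter> {\<omega>\<in>space M. N (b (Suc i) / s) \<omega> = j \<and> N (b (Suc i)) \<omega> = j \<and>
        N (b i) \<omega> = Suc j \<and> N t \<omega> = Suc j} \<inter> H \<subseteq> cell i"
      proof
        fix \<omega> assume w: "\<omega> \<in> A \<inter> {\<omega>\<in>space M. N (b (Suc i) / s) \<omega> = j \<and> N (b (Suc i)) \<omega> = j \<and>
          N (b i) \<omega> = Suc j \<and> N t \<omega> = Suc j} \<inter> H"
        then have "R j \<omega> \<le> b (Suc i) / s" "R (Suc j) \<omega> \<le> b i" "\<not> R (Suc j) \<omega> \<le> b (Suc i)"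
          using R_le[of \<omega> "b (Suc i) / s" j] R_le[of \<omega> "b i" "Suc j"]
            R_le_iff[of \<omega> t "Suc j" "b (Suc i)"] u b[of i] b[of "Suc i"] t by auto
        moreover from this have "s * R j \<omega> \<le> b (Suc i)"
          using s by (simp add: field_simps)
        ultimately show "\<omega> \<in> cell i"
          using w by (auto simp: cell_def F_def)
      qed
    qed simp
    finally show ?thesis .
  qed
  \<comment> \<open>A necessary condition for the cell: \<open>R (Suc j) \<omega> \<le> b i\<close>
    forces \<open>R j \<omega>\<close> below \<open>b i / s\<close>. The hypothesis
    \<open>1 / s \<le> q\<close> keeps this radius within the inner radius of the shell, where there
    are at most \<open>j\<close> points.\<close>
  have upper: "prob (cell i) \<le> T (b i / s) i" for i
  proof -
    have "b i * (1 / s) \<le> b i * q"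
      using b[of i] q by (intro mult_left_mono) auto
    then have u: "0 < b i / s" "b i / s \<le> b (Suc i)"
      using b[of i] s by (auto simp: b_def ac_simps)
    have "prob (cell i) \<le> prob (A \<inter> {\<omega>\<in>space M. N (b i / s) \<omega> = j \<and> N (b (Suc i)) \<omega> = j \<and>
        N (b i) \<omega> = Suc j \<and> N t \<omega> = Suc j} \<inter> H)"
    proof (rule finite_measure_mono)
      show "cell i \<subseteq> A \<inter> {\<omega>\<in>space M. N (b i / s) \<omega> = j \<and> N (b (Suc i)) \<omega> = j \<and>
        N (b i) \<omega> = Suc j \<and> N t \<omega> = Suc j} \<inter> H"
      proof
        fix \<omega> assume "\<omega> \<in> cell i"
        then have w: "\<omega> \<in> A" "\<omega> \<in> space M" "\<omega> \<in> H" "s * R j \<omega> < R (Suc j) \<omega>" "N t \<omega> = Suc j"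
            "b (Suc i) < R (Suc j) \<omega>" "R (Suc j) \<omega> \<le> b i"
          by (auto simp: cell_def F_def)
        have "R j \<omega> \<le> b i / s"
          using w s by (simp add: field_simps)
        then have "j \<le> N (b i / s) \<omega>"
          using R_le_iff[of \<omega> t j "b i / s"] w t u by simp
        moreover have "\<not> Suc j \<le> N (b (Suc i)) \<omega>"
          using R_le_iff[of \<omega> t "Suc j" "b (Suc i)"] w t b[of "Suc i"] by simp
        moreover have "Suc j \<le> N (b i) \<omega>"
          using R_le_iff[of \<omega> t "Suc j" "b i"] w t b[of i] by simp
        moreover have "N (b i / s) \<omega> \<le> N (b (Suc i)) \<omega>" "N (b i) \<omega> \<le> N t \<omega>"
          using N_mono[OF w(2) u(2)] N_mono[OF w(2) b(3)] by auto
        ultimately show "\<omega> \<in> A \<inter> {\<omega>\<in>space M. N (b i / s) \<omega> = j \<and> N (b (Suc i)) \<omega> = j \<and>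
            N (b i) \<omega> = Suc j \<and> N t \<omega> = Suc j} \<inter> H"
          using w by auto
      qed
    qed simp
    also have "\<dots> = T (b i / s) i"
      unfolding T_def H_def by (rule prob_cell[OF A u b(2) b(3) adm])
    finally show ?thesis .
  qed
  \<comment> \<open>Volumes scale with the d-th power of the radius, so a grid of ratio
    \<open>q\<close> gives means of ratio \<open>Q\<close>.\<close>
  have Vb: "V (b i) - V (b (Suc i)) = V t * (1 - Q) * Q ^ i" for i
  proof -
    have "V (b i) = V t * Q ^ i" for i
      using b[of i] t by (simp add: V_eq b_def Q_def d_def power_mult_distrib power_mult[symmetric] mult.commute)
    then show ?thesis
      by (simp add: algebra_simps)
  qed
  have Vbs: "V (b i / s) ^ j = V t ^ j * (1 / s) ^ (j * d) * (Q ^ j) ^ i" for i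
  proof -
    have "V (b i / s) = V t * (1 / s) ^ d * Q ^ i"
      using b[of i] t s
      by (simp add: V_eq b_def Q_def d_def power_mult_distrib power_mult[symmetric] mult.commute power_divide)
    then show ?thesis
      by (simp add: power_mult_distrib power_mult[symmetric] mult.commute)
  qed
  \<comment> \<open>Singling out the outermost point produces a factor \<open>Suc j\<close>. The
    series compensates for it in the limit, since (1 - Q) / (1 - Q^(j+1)) tends to 1 / (j+1) as Q
    tends to 1.\<close>
  have P: "poisson_mass (V t) (Suc j) * real (Suc j) = V t ^ j / fact j * V t * exp (- V t)"
    by (simp add: poisson_mass_def del: of_nat_Suc)
  have U: "T (b i / s) i = W * (real (Suc j) * (1 - Q)) * (Q ^ Suc j) ^ i" for i
  proof -
    have "T (b i / s) i = c * (1 / s) ^ (j * d) * (V t ^ j / fact j * V t * exp (- V t)) * (1 - Q) *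
        (Q ^ i * (Q ^ j) ^ i) * prob H"
      by (simp add: T_def Vb Vbs mult_ac)
    also have "\<dots> = c * (1 / s) ^ (j * d) * (poisson_mass (V t) (Suc j) * real (Suc j)) * (1 - Q) *
        (Q ^ i * (Q ^ j) ^ i) * prob H"
      by (simp only: P)
    also have "\<dots> = W * (real (Suc j) * (1 - Q)) * (Q ^ Suc j) ^ i"
      by (simp only: W_def d_def H_def power_Suc power_mult_distrib mult_ac)
    finally show ?thesis .
  qed
  have L: "T (b (Suc i) / s) i = W * (real (Suc j) * (1 - Q)) * Q ^ j * (Q ^ Suc j) ^ i" for i
  proof -
    have "T (b (Suc i) / s) i = T (b i / s) i * Q ^ j"
      by (simp add: T_def Vbs mult_ac power_commutes)
    then show ?thesis
      by (simp add: U mult_ac)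
  qed
  have geo: "(\<lambda>i. (Q ^ Suc j) ^ i) sums (1 / (1 - Q ^ Suc j))"
    using Q by (intro geometric_sums) (simp add: power_less_one_iff del: power_Suc)
  have W0: "0 \<le> W"
    using c s by (simp add: W_def poisson_mass_nonneg V_nonneg)
  let ?g = "real (Suc j) * (1 - Q) / (1 - Q ^ Suc j)"
  have "W * (real (Suc j) * (1 - Q)) * Q ^ j * (1 / (1 - Q ^ Suc j)) \<le> G"
    using sums_le[OF lower[unfolded L] sums_mult[OF geo] G] .
  then have "W * (Q ^ j * ?g) \<le> G"
    by (simp add: field_simps)
  moreover have "W * Q ^ j \<le> W * (Q ^ j * ?g)"
    using geometric_ratio_bounds(1)[OF Q, of j] W0 by (intro mult_left_mono)
  ultimately show "W * q ^ (j * DIM('a)) \<le> G"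
    by (simp add: Q_def d_def power_mult[symmetric] mult.commute)
  have "G \<le> W * (real (Suc j) * (1 - Q)) * (1 / (1 - Q ^ Suc j))"
    using sums_le[OF upper[unfolded U] G sums_mult[OF geo]] .
  then have "G * Q ^ j \<le> W * (real (Suc j) * (1 - Q)) * (1 / (1 - Q ^ Suc j)) * Q ^ j"
    using Q by (intro mult_right_mono) auto
  also have "\<dots> = W * (Q ^ j * ?g)"
    by (simp add: field_simps)
  also have "\<dots> \<le> W * 1"
    using geometric_ratio_bounds(2)[OF Q, of j] W0 by (intro mult_left_mono)
  finally show "G * q ^ (j * DIM('a)) \<le> W"
    by (simp add: Q_def d_def power_mult[symmetric] mult.commute)
qed

text \<open>Both error factors of the preceding bounds tend to 1 as q tends to 1 from below. The
  exponent reflects that, given the outermost of \<open>Suc j\<close> points, each of the other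
  \<open>j\<close> must fall within \<open>1 / s\<close> times its distance, with probability
  (1/s)^d each.\<close>

lemma count_indep_ratio:
  assumes A: "count_indep A j c" and s: "1 < s"
  shows "count_indep (A \<inter> {\<omega>\<in>space M. s * R j \<omega> < R (Suc j) \<omega>}) (Suc j) (c * (1 / s) ^ (j * DIM('a)))"
  unfolding count_indep_def
proof (intro conjI allI impI)
  have [measurable]: "A \<in> events"
    using A by (simp add: count_indep_def)
  show "A \<inter> {\<omega>\<in>space M. s * R j \<omega> < R (Suc j) \<omega>} \<in> events"
    by measurable
  show "0 \<le> c * (1 / s) ^ (j * DIM('a))"
    using A s by (simp add: count_indep_def)
  fix t :: real and n B m assume t: "0 < t" and adm: "admissible t n B"
  let ?p = "j * DIM('a)"
  let ?G = "prob (A \<inter> {\<omega>\<in>space M. s * R j \<omega> < R (Suc j) \<omega>} \<inter> {\<omega>\<in>space M. N t \<omega> = Suc j} \<inter> counts n B m)"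
  let ?W = "c * (1 / s) ^ ?p * poisson_mass (V t) (Suc j) * prob (counts n B m)"
  have ev: "\<forall>\<^sub>F q in at_left (1::real). q \<in> {1 / s<..<1}"
    using s by (intro eventually_at_left_real) auto
  have lim: "((\<lambda>q. X * q ^ ?p) \<longlongrightarrow> X) (at_left 1)" for X :: real
    by (auto intro!: tendsto_eq_intros)
  have "?W \<le> ?G"
  proof (rule tendsto_upperbound[OF lim])
    show "\<forall>\<^sub>F q in at_left 1. ?W * q ^ ?p \<le> ?G"
      using ev by eventually_elim (use count_indep_ratio_bounds(1)[OF A s t adm] in auto)
  qed simp
  moreover have "?G \<le> ?W"
  proof (rule tendsto_upperbound[OF lim])
    show "\<forall>\<^sub>F q in at_left 1. ?G * q ^ ?p \<le> ?W"
      using ev by eventually_elim (use count_indep_ratio_bounds(2)[OF A s t adm] in auto)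
  qed simp
  ultimately show "?G = ?W"
    by simp
qed

section \<open>Dropping conditions and removing the conditioning\<close>

text \<open>A condition on the new ratio with threshold s > 1 is imposed and then relaxed.
  Intersecting it with \<open>A\<close> gives the lower bound. Applying the same law to the whole
  space bounds the mass lost, \<open>w - w * (1 / s) ^ p\<close>, which vanishes as s decreases to
  1.\<close>

lemma count_indep_Suc:
  assumes A: "count_indep A j c"
  shows "count_indep A (Suc j) c"
  unfolding count_indep_def
proof (intro conjI allI impI)
  show [measurable]: "A \<in> events" and "0 \<le> c"
    using A by (auto simp: count_indep_def)
  fix t :: real and n B m assume t: "0 < t" and adm: "admissible t n B"
  define E where "E s = {\<omega>\<in>space M. s * R j \<omega> < R (Suc j) \<omega>}" for s
  define F where "F = {\<omega>\<in>space M. N t \<omega> = Suc j} \<inter> counts n B m"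
  define p where "p = j * DIM('a)"
  define w where "w = poisson_mass (V t) (Suc j) * prob (counts n B m)"
  have [measurable]: "F \<in> events" "E s \<in> events" for s
    using counts_events[OF adm] unfolding F_def E_def by measurable
  have AE: "prob (A \<inter> E s \<inter> F) = c * w * (1 / s) ^ p" if "1 < s" for s
    using count_indepD[OF count_indep_ratio[OF A that] t adm, of m]
    by (simp add: E_def F_def w_def p_def Int_assoc)
  have SE: "prob (space M \<inter> E s \<inter> F) = w * (1 / s) ^ p" if "1 < s" for s
    using count_indepD[OF count_indep_ratio[OF count_indep_space that] t adm, of j m]
    by (simp add: E_def F_def w_def p_def Int_assoc)
  have w: "prob F = w"
    using count_indepD[OF count_indep_space t adm, of "Suc j" m]
    by (simp add: F_def w_def Int_assoc[symmetric] Int_absorb1 subset_eq)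
  have lower: "c * w * (1 / s) ^ p \<le> prob (A \<inter> F)" if "1 < s" for s
    unfolding AE[OF that, symmetric] by (intro finite_measure_mono) auto
  have upper: "prob (A \<inter> F) \<le> c * w * (1 / s) ^ p + (w - w * (1 / s) ^ p)" if "1 < s" for s
  proof -
    have "prob (A \<inter> F) \<le> prob ((A \<inter> E s \<inter> F) \<union> (F - E s \<inter> F))"
      by (intro finite_measure_mono) auto
    also have "\<dots> \<le> prob (A \<inter> E s \<inter> F) + prob (F - E s \<inter> F)"
      by (intro measure_Un_le) auto
    also have "prob (F - E s \<inter> F) = prob F - prob (E s \<inter> F)"
      by (intro finite_measure_Diff) auto
    also have "E s \<inter> F = space M \<inter> E s \<inter> F"
      by (auto simp: E_def)
    finally show ?thesis
      by (simp only: AE[OF that] SE[OF that] w)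
  qed
  have ev: "\<forall>\<^sub>F s in at_right (1::real). s \<in> {1<..<2}"
    by (intro eventually_at_right_real) auto
  have "c * w \<le> prob (A \<inter> F)"
  proof (rule tendsto_upperbound)
    show "((\<lambda>s. c * w * (1 / s) ^ p) \<longlongrightarrow> c * w) (at_right 1)"
      by (auto intro!: tendsto_eq_intros)
    show "\<forall>\<^sub>F s in at_right 1. c * w * (1 / s) ^ p \<le> prob (A \<inter> F)"
      using ev by eventually_elim (use lower in auto)
  qed simp
  moreover have "prob (A \<inter> F) \<le> c * w"
  proof (rule tendsto_lowerbound)
    show "((\<lambda>s. c * w * (1 / s) ^ p + (w - w * (1 / s) ^ p)) \<longlongrightarrow> c * w) (at_right 1)"
      by (auto intro!: tendsto_eq_intros)
    show "\<forall>\<^sub>F s in at_right 1. prob (A \<inter> F) \<le> c * w * (1 / s) ^ p + (w - w * (1 / s) ^ p)"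
      using ev by eventually_elim (use upper in auto)
  qed simp
  ultimately show "prob (A \<inter> {\<omega>\<in>space M. N t \<omega> = Suc j} \<inter> counts n B m) =
      c * poisson_mass (V t) (Suc j) * prob (counts n B m)"
    by (simp add: F_def w_def Int_assoc)
qed

text \<open>The complement is a finite sum of Poisson masses, each tending to 0 as the mean
  grows.\<close>

lemma prob_N_ge_tendsto: "(\<lambda>m. prob {\<omega>\<in>space M. L \<le> N (real m) \<omega>}) \<longlonglongrightarrow> 1"
proof -
  have eq: "prob {\<omega>\<in>space M. L \<le> N (real m) \<omega>} = 1 - (\<Sum>k<L. V (real m) ^ k / exp (V (real m)) / fact k)" for m
  proof -
    have "prob {\<omega>\<in>space M. L \<le> N (real m) \<omega>} = prob (space M - (\<Union>k\<in>{..<L}. {\<omega>\<in>space M. N (real m) \<omega> = k}))"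
      by (intro arg_cong[where f = prob]) auto
    also have "\<dots> = 1 - prob (\<Union>k\<in>{..<L}. {\<omega>\<in>space M. N (real m) \<omega> = k})"
      by (intro prob_compl sets.finite_UN) auto
    also have "prob (\<Union>k\<in>{..<L}. {\<omega>\<in>space M. N (real m) \<omega> = k}) =
        (\<Sum>k<L. prob {\<omega>\<in>space M. N (real m) \<omega> = k})"
      by (intro finite_measure_finite_Union) (auto simp: disjoint_family_on_def)
    also have "\<dots> = (\<Sum>k<L. V (real m) ^ k / exp (V (real m)) / fact k)"
      unfolding prob_N by (simp add: poisson_mass_def exp_minus field_simps)
    finally show ?thesis .
  qed
  have "filterlim (\<lambda>m. V (real m)) at_top sequentially"
    unfolding V_eq[OF of_nat_0_le_iff]
    by (intro filterlim_tendsto_pos_mult_at_top[OF tendsto_const kappa_pos]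
        filterlim_pow_at_top filterlim_real_sequentially) simp
  then have "(\<lambda>m. V (real m) ^ k / exp (V (real m))) \<longlonglongrightarrow> 0" for k
    by (rule filterlim_compose[OF tendsto_power_div_exp_0])
  then have "(\<lambda>m. 1 - (\<Sum>k<L. V (real m) ^ k / exp (V (real m)) / fact k)) \<longlonglongrightarrow> 1 - (\<Sum>k<L. 0 / fact k)"
    by (intro tendsto_intros) auto
  then show ?thesis
    by (simp add: eq)
qed

text \<open>Almost surely no point sits at \<open>x\<close>, and almost surely some ball contains
  \<open>l\<close> points, so that \<open>R l\<close> is a genuine distance.\<close>

lemma AE_R_pos:
  assumes "1 \<le> l"
  shows "AE \<omega> in M. 0 < R l \<omega>"
proof -
  let ?F = "{\<omega>\<in>space M. \<exists>m::nat. l \<le> N (real m) \<omega>}"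
  have F: "?F \<in> events"
    by measurable
  have "1 \<le> prob ?F"
    using prob_N_ge_tendsto[of l]
  proof (rule tendsto_upperbound)
    show "\<forall>\<^sub>F m in sequentially. prob {\<omega>\<in>space M. l \<le> N (real m) \<omega>} \<le> prob ?F"
      using F by (intro always_eventually allI finite_measure_mono) auto
  qed simp
  then have "prob ?F = 1"
    using prob_le_1[of ?F] by simp
  then have "AE \<omega> in M. \<exists>m::nat. l \<le> N (real m) \<omega>"
    using F prob_Collect_eq_1[of "\<lambda>\<omega>. \<exists>m::nat. l \<le> N (real m) \<omega>"] by blast
  then show ?thesis
    using AE_N_0 AE_space
  proof eventually_elim
    case (elim \<omega>)
    then obtain m :: nat where "l \<le> N (real m) \<omega>"
      by blast
    then have "\<not> R l \<omega> \<le> 0"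
      using R_le_iff[of \<omega> "real m" l 0] elim assms by simp
    then show ?case
      by simp
  qed
qed

lemma count_indep_add: "count_indep A j c \<Longrightarrow> count_indep A (j + i) c"
  by (induction i) (auto intro: count_indep_Suc)

text \<open>By \<open>count_indep_add\<close> the constant \<open>c\<close> is the same for every
  number of points from \<open>j\<close> on. Summing over these numbers shows that \<open>A\<close>
  has conditional probability \<open>c\<close> given at least \<open>j\<close> points in the ball,
  and the probability of that condition tends to 1.\<close>

lemma prob_of_count_indep:
  assumes A: "count_indep A j c"
  shows "prob A = c"
proof -
  have [measurable]: "A \<in> events" and c: "0 \<le> c"
    using A by (auto simp: count_indep_def)
  have mass: "prob (A \<inter> {\<omega>\<in>space M. N t \<omega> = j + i}) = c * prob {\<omega>\<in>space M. N t \<omega> = j + i}" if "0 < t" for t i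
  proof -
    \<comment> \<open>With an empty family, \<open>counts\<close> is all of \<open>space M\<close>,
      so nothing is prescribed outside the ball.\<close>
    have "admissible t 0 (\<lambda>_. {})"
      by (simp add: admissible_def disjoint_family_on_def)
    from count_indepD[OF count_indep_add[OF A] that this]
    have "prob (A \<inter> {\<omega>\<in>space M. N t \<omega> = j + i} \<inter> space M) = c * poisson_mass (V t) (j + i)"
      by (simp add: counts_def prob_space)
    moreover have "A \<inter> {\<omega>\<in>space M. N t \<omega> = j + i} \<inter> space M = A \<inter> {\<omega>\<in>space M. N t \<omega> = j + i}"
      by auto
    ultimately show ?thesis
      by (simp add: prob_N)
  qed
  have ge: "prob (A \<inter> {\<omega>\<in>space M. j \<le> N t \<omega>}) = c * prob {\<omega>\<in>space M. j \<le> N t \<omega>}" if "0 < t" for t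
  proof -
    have "(\<lambda>i. prob {\<omega>\<in>space M. N t \<omega> = j + i}) sums prob (\<Union>i. {\<omega>\<in>space M. N t \<omega> = j + i})"
      by (intro finite_measure_UNION) (auto simp: disjoint_family_on_def)
    moreover have "(\<Union>i. {\<omega>\<in>space M. N t \<omega> = j + i}) = {\<omega>\<in>space M. j \<le> N t \<omega>}"
      by (auto simp: le_iff_add)
    moreover have "(\<lambda>i. prob (A \<inter> {\<omega>\<in>space M. N t \<omega> = j + i})) sums prob (\<Union>i. A \<inter> {\<omega>\<in>space M. N t \<omega> = j + i})"
      by (intro finite_measure_UNION) (auto simp: disjoint_family_on_def)
    moreover have "(\<Union>i. A \<inter> {\<omega>\<in>space M. N t \<omega> = j + i}) = A \<inter> {\<omega>\<in>space M. j \<le> N t \<omega>}"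
      by (auto simp: le_iff_add)
    ultimately show ?thesis
      unfolding mass[OF that] by (intro sums_unique2[OF _ sums_mult]) simp_all
  qed
  define p where "p m = prob {\<omega>\<in>space M. j \<le> N (real m) \<omega>}" for m
  have lim: "p \<longlonglongrightarrow> 1"
    unfolding p_def by (rule prob_N_ge_tendsto)
  have lower: "c * p m \<le> prob A" if "0 < m" for m
    using ge[of "real m"] that finite_measure_mono[of "A \<inter> {\<omega>\<in>space M. j \<le> N (real m) \<omega>}" A]
    by (simp add: p_def)
  have upper: "prob A \<le> c * p m + (1 - p m)" if "0 < m" for m
  proof -
    have "prob A \<le> prob ((A \<inter> {\<omega>\<in>space M. j \<le> N (real m) \<omega>}) \<union> (space M - {\<omega>\<in>space M. j \<le> N (real m) \<omega>}))"
      using sets.sets_into_space[OF \<open>A \<in> events\<close>] by (intro finite_measure_mono) auto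
    also have "\<dots> \<le> prob (A \<inter> {\<omega>\<in>space M. j \<le> N (real m) \<omega>}) +
        prob (space M - {\<omega>\<in>space M. j \<le> N (real m) \<omega>})"
      by (intro measure_Un_le) auto
    also have "prob (space M - {\<omega>\<in>space M. j \<le> N (real m) \<omega>}) = 1 - p m"
      unfolding p_def by (intro prob_compl) auto
    finally show ?thesis
      using ge[of "real m"] that by (simp add: p_def)
  qed
  have "c \<le> prob A"
  proof (rule tendsto_upperbound)
    show "(\<lambda>m. c * p m) \<longlonglongrightarrow> c"
      using tendsto_mult[OF tendsto_const lim, of c] by simp
    show "\<forall>\<^sub>F m in sequentially. c * p m \<le> prob A"
      using eventually_gt_at_top[of 0] by eventually_elim (rule lower)
  qed simp
  moreover have "prob A \<le> c"
  proof (rule tendsto_lowerbound)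
    show "(\<lambda>m. c * p m + (1 - p m)) \<longlonglongrightarrow> c"
      by (rule tendsto_eq_intros lim refl | simp)+
    show "\<forall>\<^sub>F m in sequentially. prob A \<le> c * p m + (1 - p m)"
      using eventually_gt_at_top[of 0] by eventually_elim (rule upper)
  qed simp
  ultimately show ?thesis
    by simp
qed

section \<open>Joint tail probabilities of the ratios\<close>

abbreviation \<mu> :: "nat \<Rightarrow> 'w \<Rightarrow> real" where
  "\<mu> l \<omega> \<equiv> R l \<omega> / R (l - 1) \<omega>"

text \<open>The survival function of the Pareto law with scale 1 and shape (l - 1) d. The
  \<open>max\<close> gives it the value 1 at thresholds up to 1, where no condition is
  imposed.\<close>

definition ratio_tail :: "real \<Rightarrow> nat \<Rightarrow> real" where
  "ratio_tail s l = (1 / max 1 s) ^ ((l - 1) * DIM('a))"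

text \<open>Points are added one at a time, by \<open>count_indep_ratio\<close> if the new ratio is
  constrained and by \<open>count_indep_Suc\<close> if it is not. Writing the constraint as a
  product avoids division by a distance that might be 0.\<close>

lemma count_indep_ratios:
  assumes "1 \<le> n"
  shows "count_indep {\<omega>\<in>space M. \<forall>l\<in>{2..n}. 1 < s l \<longrightarrow> s l * R (l - 1) \<omega> < R l \<omega>} n
    (\<Prod>l=2..n. ratio_tail (s l) l)"
  using assms
proof (induction n rule: dec_induct)
  case base
  then show ?case
    using count_indep_space[of 1] by simp
next
  case (step n)
  have I: "{2..Suc n} = insert (Suc n) {2..n}"
    using step.hyps by auto
  let ?E = "\<lambda>n. {\<omega>\<in>space M. \<forall>l\<in>{2..n}. 1 < s l \<longrightarrow> s l * R (l - 1) \<omega> < R l \<omega>}"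
  have P: "(\<Prod>l=2..Suc n. ratio_tail (s l) l) = (\<Prod>l=2..n. ratio_tail (s l) l) * ratio_tail (s (Suc n)) (Suc n)"
    unfolding I by simp
  show ?case
  proof (cases "1 < s (Suc n)")
    case True
    then have "?E (Suc n) = ?E n \<inter> {\<omega>\<in>space M. s (Suc n) * R n \<omega> < R (Suc n) \<omega>}"
      unfolding I by auto
    then show ?thesis
      unfolding P using count_indep_ratio[OF step.IH True] True by (simp add: ratio_tail_def max_def)
  next
    case False
    then have "?E (Suc n) = ?E n"
      unfolding I by auto
    then show ?thesis
      unfolding P using count_indep_Suc[OF step.IH] False by (simp add: ratio_tail_def max_def)
  qed
qed

lemma prob_ratios_aux:
  assumes J: "J \<subseteq> {2..L}" and L: "1 \<le> L"
  shows "prob {\<omega>\<in>space M. \<forall>l\<in>J. 1 < s l \<longrightarrow> s l < \<mu> l \<omega>} = (\<Prod>l\<in>J. ratio_tail (s l) l)"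
proof -
  \<comment> \<open>The threshold 0 outside \<open>J\<close> disables the guard there and makes the
    corresponding factor \<open>ratio_tail 0 l = 1\<close>.\<close>
  define s' where "s' l = (if l \<in> J then s l else 0)" for l
  let ?E = "{\<omega>\<in>space M. \<forall>l\<in>{2..L}. 1 < s' l \<longrightarrow> s' l * R (l - 1) \<omega> < R l \<omega>}"
  have fin: "finite J"
    using J finite_subset by blast
  have "AE \<omega> in M. \<forall>l\<in>J. 0 < R (l - 1) \<omega>"
  proof (intro AE_finite_allI[OF fin] AE_R_pos)
    fix l assume "l \<in> J"
    then show "1 \<le> l - 1"
      using J by fastforce
  qed
  then have "AE \<omega> in M. \<omega> \<in> {\<omega>\<in>space M. \<forall>l\<in>J. 1 < s l \<longrightarrow> s l < \<mu> l \<omega>} \<longleftrightarrow> \<omega> \<in> ?E"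
  proof eventually_elim
    case (elim \<omega>)
    then show ?case
      using J by (auto simp: s'_def pos_less_divide_eq)
  qed
  then have "prob {\<omega>\<in>space M. \<forall>l\<in>J. 1 < s l \<longrightarrow> s l < \<mu> l \<omega>} = prob ?E"
    using fin by (intro finite_measure_eq_AE) (measurable)
  also have "\<dots> = (\<Prod>l=2..L. ratio_tail (s' l) l)"
    by (rule prob_of_count_indep[OF count_indep_ratios[OF L]])
  also have "\<dots> = (\<Prod>l\<in>J. ratio_tail (s l) l)"
    using J by (intro prod.mono_neutral_cong_right) (auto simp: s'_def ratio_tail_def max_def)
  finally show ?thesis .
qed

text \<open>The event contains \<open>s < \<mu> l \<omega>\<close> for every s > 1, and the tail at
  s tends to 1 as s decreases to 1.\<close>

lemma AE_ratio_gt_1: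
  assumes "2 \<le> l"
  shows "AE \<omega> in M. 1 < \<mu> l \<omega>"
proof -
  have ge: "ratio_tail s l \<le> prob {\<omega>\<in>space M. 1 < \<mu> l \<omega>}" if "1 < s" for s
  proof -
    have "ratio_tail s l = prob {\<omega>\<in>space M. s < \<mu> l \<omega>}"
      using prob_ratios_aux[of "{l}" l "\<lambda>_. s"] assms that by simp
    also have "\<dots> \<le> prob {\<omega>\<in>space M. 1 < \<mu> l \<omega>}"
      using that by (intro finite_measure_mono) auto
    finally show ?thesis .
  qed
  have "1 \<le> prob {\<omega>\<in>space M. 1 < \<mu> l \<omega>}"
  proof (rule tendsto_upperbound)
    show "((\<lambda>s. ratio_tail s l) \<longlongrightarrow> 1) (at_right 1)"
      unfolding ratio_tail_def by (auto intro!: tendsto_eq_intros)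
    show "\<forall>\<^sub>F s in at_right 1. ratio_tail s l \<le> prob {\<omega>\<in>space M. 1 < \<mu> l \<omega>}"
      using ge eventually_at_right_less[of 1] by (auto elim: eventually_mono)
  qed simp
  then have "prob {\<omega>\<in>space M. 1 < \<mu> l \<omega>} = 1"
    using prob_le_1 by (intro antisym)
  then show ?thesis
    by (subst (asm) prob_Collect_eq_1) auto
qed

text \<open>Since all ratios exceed 1 almost surely, thresholds up to 1 constrain nothing and the
  guard can be removed.\<close>

lemma prob_ratios:
  assumes J: "J \<subseteq> {2..L}" and L: "1 \<le> L"
  shows "prob {\<omega>\<in>space M. \<forall>l\<in>J. s l < \<mu> l \<omega>} = (\<Prod>l\<in>J. ratio_tail (s l) l)"
proof -
  have fin: "finite J"
    using J finite_subset by blast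
  have "AE \<omega> in M. \<forall>l\<in>J. 1 < \<mu> l \<omega>"
    using fin J by (intro AE_finite_allI AE_ratio_gt_1) auto
  then have "AE \<omega> in M. \<omega> \<in> {\<omega>\<in>space M. \<forall>l\<in>J. s l < \<mu> l \<omega>} \<longleftrightarrow>
      \<omega> \<in> {\<omega>\<in>space M. \<forall>l\<in>J. 1 < s l \<longrightarrow> s l < \<mu> l \<omega>}"
    by eventually_elim fastforce
  then have "prob {\<omega>\<in>space M. \<forall>l\<in>J. s l < \<mu> l \<omega>} =
      prob {\<omega>\<in>space M. \<forall>l\<in>J. 1 < s l \<longrightarrow> s l < \<mu> l \<omega>}"
    using fin by (intro finite_measure_eq_AE) (measurable)
  then show ?thesis
    using prob_ratios_aux[OF J L] by simp
qed

section \<open>Independence and the Pareto law\<close>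

text \<open>The open upper half-lines are closed under intersection and generate the Borel sets, so
  it suffices that joint tails factor. \<open>prob_ratios\<close> gives this for every finite
  subset, and its singleton case identifies the factors.\<close>

lemma indep_vars_ratios:
  assumes L: "1 \<le> L"
  shows "indep_vars (\<lambda>_. borel) \<mu> {2..L}"
proof -
  define G where "G l = {\<mu> l -` A \<inter> space M | A. A \<in> range greaterThan}" for l
  have G: "\<mu> l -` {a<..} \<inter> space M = {\<omega>\<in>space M. a < \<mu> l \<omega>}" for l a
    by auto
  have "indep_sets G {2..L}"
  proof (rule indep_setsI)
    show "G l \<subseteq> events" for l
      unfolding G_def by (auto simp: G)
    fix A J assume J: "J \<noteq> {}" "J \<subseteq> {2..L}" "finite J" and A: "\<forall>j\<in>J. A j \<in> G j"
    have "\<forall>j\<in>J. \<exists>a. A j = {\<omega>\<in>space M. a < \<mu> j \<omega>}"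
      using A by (fastforce simp: G_def G)
    then obtain a where a: "\<And>j. j \<in> J \<Longrightarrow> A j = {\<omega>\<in>space M. a j < \<mu> j \<omega>}"
      by metis
    have "(\<Inter>j\<in>J. A j) = {\<omega>\<in>space M. \<forall>j\<in>J. a j < \<mu> j \<omega>}"
      using a J(1) by auto
    then have "prob (\<Inter>j\<in>J. A j) = (\<Prod>j\<in>J. ratio_tail (a j) j)"
      using prob_ratios[OF J(2) L] by simp
    also have "\<dots> = (\<Prod>j\<in>J. prob (A j))"
    proof (rule prod.cong)
      fix j assume j: "j \<in> J"
      then show "ratio_tail (a j) j = prob (A j)"
        using prob_ratios[of "{j}" L a] J(2) L a[OF j] by auto
    qed simp
    finally show "prob (\<Inter>j\<in>J. A j) = (\<Prod>j\<in>J. prob (A j))" .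
  qed
  moreover have "Int_stable (G l)" for l
  proof (rule Int_stableI)
    fix A B assume "A \<in> G l" "B \<in> G l"
    then obtain a b where "A = \<mu> l -` {a<..} \<inter> space M" "B = \<mu> l -` {b<..} \<inter> space M"
      by (auto simp: G_def)
    then have "A \<inter> B = \<mu> l -` {max a b<..} \<inter> space M"
      by auto
    then show "A \<inter> B \<in> G l"
      by (auto simp: G_def)
  qed
  ultimately have "indep_sets (\<lambda>l. sigma_sets (space M) (G l)) {2..L}"
    by (rule indep_sets_sigma)
  moreover have "sigma_sets (space M) (G l) = {\<mu> l -` A \<inter> space M | A. A \<in> sets borel}" for l
    unfolding G_def borel_Ioi by (subst sigma_sets_vimage_commute[symmetric]) auto
  ultimately show ?thesis
    unfolding indep_vars_def2 by simp
qed

text \<open>It suffices to compare distribution functions: the integral of the density up to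
  \<open>a\<close> and the probability of \<open>\<mu> l \<omega> \<le> a\<close> both equal 1 minus
  the tail at \<open>a\<close>.\<close>

lemma distributed_ratio:
  assumes "2 \<le> l"
  shows "distributed M lborel (\<mu> l) (\<lambda>t. ennreal (pareto_density (real (l - 1) * real DIM('a)) t))"
proof (rule distributedI_borel_atMost)
  let ?\<alpha> = "real (l - 1) * real DIM('a)"
  show "pareto_density ?\<alpha> \<in> borel_measurable borel"
    unfolding pareto_density_def by measurable
  show "AE t in lborel. 0 \<le> pareto_density ?\<alpha> t"
    by (simp add: pareto_density_def)
  fix a :: real
  show "(\<integral>\<^sup>+t. ennreal (pareto_density ?\<alpha> t * indicator {..a} t) \<partial>lborel) =
      ennreal (1 - max 1 a powr (- ?\<alpha>))"
    using assms by (intro nn_integral_pareto_density_atMost) simp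
  have "prob {\<omega>\<in>space M. \<mu> l \<omega> \<le> a} = prob (space M - {\<omega>\<in>space M. a < \<mu> l \<omega>})"
    by (intro arg_cong[where f = prob]) auto
  also have "\<dots> = 1 - prob {\<omega>\<in>space M. a < \<mu> l \<omega>}"
    by (intro prob_compl) auto
  also have "prob {\<omega>\<in>space M. a < \<mu> l \<omega>} = ratio_tail a l"
    using prob_ratios[of "{l}" l "\<lambda>_. a"] assms by simp
  also have "ratio_tail a l = max 1 a powr (- ?\<alpha>)"
    by (simp add: ratio_tail_def powr_minus powr_realpow[symmetric] power_divide field_simps flip: of_nat_mult)
  finally show "emeasure M {\<omega>\<in>space M. \<mu> l \<omega> \<le> a} = ennreal (1 - max 1 a powr (- ?\<alpha>))"
    by (simp add: emeasure_eq_measure)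
qed simp

end

theorem theorem2:
  fixes M :: "'w measure" and \<Phi> :: "'w \<Rightarrow> 'a::euclidean_space set"
    and \<rho> :: real and x :: 'a and L :: nat
  assumes "homogeneous_PPP M \<Phi> \<rho>" and "0 < \<rho>" and "2 \<le> L"
  shows "(\<forall>l\<in>{2..L}. distributed M lborel
            (\<lambda>\<omega>. knn_dist \<Phi> x l \<omega> / knn_dist \<Phi> x (l - 1) \<omega>)
            (\<lambda>t. ennreal (pareto_density (real (l - 1) * real DIM('a)) t)))
       \<and> prob_space.indep_vars M (\<lambda>_. borel)
            (\<lambda>l \<omega>. knn_dist \<Phi> x l \<omega> / knn_dist \<Phi> x (l - 1) \<omega>) {2..L}"
proof -
  interpret prob_space M
    using assms(1) by (simp add: homogeneous_PPP_def)
  interpret homogeneous_poisson M \<Phi> \<rho> x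
    by standard (use assms in auto)
  show ?thesis
    using distributed_ratio indep_vars_ratios assms(3) by simp
qed

end
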